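(* Let $r$ be a positive integer. The map $$\psi_r:\mathscr{P}\longrightarrow\mathscr{K}_r\times\mathscr{P},\qquad \lambda\longmapsto(\mu,\nu),$$ defined by $$\mu_i=r\sum_{j\ge i}\{(\lambda_j-\lambda_{j+1})/r\},\qquad \nu_i=\sum_{j\ge i}\lfloor(\lambda_j-\lambda_{j+1})/r\rfloor\qquad\text{for all } i\ge1,$$ is a bijection such that, whenever $\psi_r(\lambda)=(\mu,\nu)$, $$r\text{-core}(\lambda)=r\text{-core}(\mu),\qquad |\lambda|=|\mu|+r|\nu|,\qquad \mathscr{H}^{(b)}_r(\lambda)=r\,\mathscr{H}^{(b)}(\nu).$$
   Context: $\mathscr{P}$ is the set of all integer partitions $\lambda=(\lambda_1,\lambda_2,\dots)$ (weakly decreasing sequences of nonnegative integers with finitely many nonzero terms, including the empty partition $0$), and $|\lambda|=\sum_i\lambda_i$. $\lfloor x\rfloor$ is the floor and $\{x\}=x-\lfloor x\rfloor\in[0,1)$ the fractional part of a real number $x$. A partition is identified with its Young diagram $\{(i,j): 1\le j\le\lambda_i\}$; $\lambda'$ is the conjugate partition. For a square $s=(i,j)\in\lambda$: arm-length $a(s)=\lambda_i-j$, leg-length $l(s)=\lambda'_j-i$, hook-length $h(s)=a(s)+l(s)+1$. A bottom square is a square $s\in\lambda$ with $l(s)=0$. $\mathscr{H}^{(b)}_r(\lambda)$ is the multiset of hook-lengths of bottom squares of $\lambda$ that are congruent to $0$ modulo $r$, and $\mathscr{H}^{(b)}(\lambda):=\mathscr{H}^{(b)}_1(\lambda)$. For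 a multiset $M$ of integers, $rM:=\{rm: m\in M\}$ (as a multiset). $\mathscr{K}_r$ is the set of $r$-kernels, i.e. partitions $\lambda$ with $\mathscr{H}^{(b)}_r(\lambda)=\emptyset$; equivalently, partitions with $\lambda_i-\lambda_{i+1}<r$ for all $i\ge1$. An $r$-core is a partition none of whose hook-lengths is a multiple of $r$. The $r$-core of a partition $\lambda$, denoted $r\text{-core}(\lambda)$, is obtained as follows: let $(s_k)_{k\in\mathbb{Z}}$ be the $0/1$-sequence of $\lambda$, where $s_k=0$ if $k=\lambda_i-i$ for some $i\ge1$ and $s_k=1$ otherwise; in each of the $r$ subsequences $(s_{i+rj})_{j\in\mathbb{Z}}$, $0\le i\le r-1$, move all zeros to the left past the ones (i.e. repeatedly exchange $s_k=1$, $s_{k+r}=0$ for $s_k=0$, $s_{k+r}=1$ until this is no longer possible); the resulting sequence is the $0/1$-sequence of $r\text{-core}(\lambda)$. *)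

theory Defs
  imports Complex_Main "HOL-Library.Multiset" "HOL-Library.Confluence"
begin

text \<open>
  Rows, columns and sequence positions are counted from \<open>0\<close>: the part usually called
  \<open>\<lambda>\<^sub>i\<close>, for \<open>i \<ge> 1\<close>, is \<open>lam (i - 1)\<close>, and the square usually called \<open>(i, j)\<close> is
  \<open>(i - 1, j - 1)\<close>.
\<close>

definition partitions :: "(nat \<Rightarrow> nat) set" where
  "partitions = {lam. antimono lam \<and> finite {i. lam i \<noteq> 0}}"

definition psize :: "(nat \<Rightarrow> nat) \<Rightarrow> nat" where
  "psize lam = (\<Sum>i. lam i)"

definition diagram :: "(nat \<Rightarrow> nat) \<Rightarrow> (nat \<times> nat) set" where
  "diagram lam = {(i, j). j < lam i}"

definition conjugate :: "(nat \<Rightarrow> nat) \<Rightarrow> nat \<Rightarrow> nat" where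
  "conjugate lam j = card {i. j < lam i}"

text \<open>The subtractions below do not truncate as long as the square lies in the diagram.\<close>

definition arm :: "(nat \<Rightarrow> nat) \<Rightarrow> nat \<times> nat \<Rightarrow> nat" where
  "arm lam s = lam (fst s) - Suc (snd s)"

definition leg :: "(nat \<Rightarrow> nat) \<Rightarrow> nat \<times> nat \<Rightarrow> nat" where
  "leg lam s = conjugate lam (snd s) - Suc (fst s)"

definition hook_length :: "(nat \<Rightarrow> nat) \<Rightarrow> nat \<times> nat \<Rightarrow> nat" where
  "hook_length lam s = arm lam s + leg lam s + 1"

definition bottom_squares :: "(nat \<Rightarrow> nat) \<Rightarrow> (nat \<times> nat) set" where
  "bottom_squares lam = {s \<in> diagram lam. leg lam s = 0}"

definition bottom_hooks :: "nat \<Rightarrow> (nat \<Rightarrow> nat) \<Rightarrow> nat multiset" where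
  "bottom_hooks r lam =
     {# h \<in># image_mset (hook_length lam) (mset_set (bottom_squares lam)). r dvd h #}"

definition r_kernels :: "nat \<Rightarrow> (nat \<Rightarrow> nat) set" where
  "r_kernels r = {lam \<in> partitions. bottom_hooks r lam = {#}}"

definition zero_one_seq :: "(nat \<Rightarrow> nat) \<Rightarrow> int \<Rightarrow> nat" where
  "zero_one_seq lam k = (if \<exists>i. k = int (lam i) - int (Suc i) then 0 else 1)"

definition core_move :: "nat \<Rightarrow> (int \<Rightarrow> nat) \<Rightarrow> (int \<Rightarrow> nat) \<Rightarrow> bool" where
  "core_move r s t \<longleftrightarrow>
     (\<exists>k. s k = 1 \<and> s (k + int r) = 0 \<and> t = s(k := 0, k + int r := 1))"

definition is_r_core_of :: "nat \<Rightarrow> (nat \<Rightarrow> nat) \<Rightarrow> (nat \<Rightarrow> nat) \<Rightarrow> bool" where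
  "is_r_core_of r lam kap \<longleftrightarrow> kap \<in> partitions
     \<and> (core_move r)\<^sup>*\<^sup>* (zero_one_seq lam) (zero_one_seq kap)
     \<and> (\<nexists>t. core_move r (zero_one_seq kap) t)"

text \<open>Existence and uniqueness are proved in \<open>ex1_r_core\<close> below.\<close>

definition r_core :: "nat \<Rightarrow> (nat \<Rightarrow> nat) \<Rightarrow> (nat \<Rightarrow> nat)" where
  "r_core r lam = (THE kap. is_r_core_of r lam kap)"

text \<open>
  For \<open>r > 0\<close> and a partition \<open>lam\<close>, the real number whose floor is taken in the first
  component is a nonnegative integer already (\<open>real_fst_psi\<close> below), and both series have
  only finitely many nonzero terms.  In the second component \<open>nat\<close> is applied to nonnegative
  integers only.
\<close>

definition psi :: "nat \<Rightarrow> (nat \<Rightarrow> nat) \<Rightarrow> (nat \<Rightarrow> nat) \<times> (nat \<Rightarrow> nat)" where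
  "psi r lam =
     (\<lambda>i. nat \<lfloor>real r * (\<Sum>j. frac ((real (lam (i + j)) - real (lam (i + j + 1))) / real r))\<rfloor>,
      \<lambda>i. \<Sum>j. nat \<lfloor>(real (lam (i + j)) - real (lam (i + j + 1))) / real r\<rfloor>)"


section \<open>The floor in the first component of \<open>psi\<close> is harmless\<close>

lemma partitions_bound:
  assumes "lam \<in> partitions"
  obtains N where "\<And>j. N \<le> j \<Longrightarrow> lam j = 0"
proof -
  from assms have "finite {i. lam i \<noteq> 0}" by (simp add: partitions_def)
  then obtain N where "\<forall>i\<in>{i. lam i \<noteq> 0}. i < N"
    using finite_nat_set_iff_bounded by blast
  then show ?thesis using that by (metis (mono_tags) leD mem_Collect_eq)
qed

lemma real_fst_psi:
  assumes r: "r > 0" and lam: "lam \<in> partitions"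
  shows "real (fst (psi r lam) i) =
    real r * (\<Sum>j. frac ((real (lam (i + j)) - real (lam (i + j + 1))) / real r))"
    (is "_ = real r * suminf ?f")
proof -
  obtain N where N: "\<And>j. N \<le> j \<Longrightarrow> lam j = 0"
    using partitions_bound[OF lam] by blast
  have le: "lam (Suc k) \<le> lam k" for k
    using lam by (auto simp: partitions_def antimono_def)
  define d where "d j = lam (i + j) - lam (i + j + 1)" for j
  have f: "?f j = real (d j mod r) / real r" for j
  proof -
    have "real (lam (i + j)) - real (lam (i + j + 1)) = real (d j)"
      using le[of "i + j"] by (simp add: d_def of_nat_diff)
    moreover have "real (d j) / real r = real (d j mod r) / real r + of_int (int (d j div r))"
    proof -
      have "real (d j) = real (d j mod r) + real r * real (d j div r)"
        by (simp flip: of_nat_mult of_nat_add)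
      then show ?thesis using r by (simp add: field_simps)
    qed
    ultimately have "?f j = frac (real (d j mod r) / real r + of_int (int (d j div r)))"
      by simp
    also have "\<dots> = real (d j mod r) / real r"
      using r by (subst frac_unique_iff) simp
    finally show ?thesis .
  qed
  have "suminf ?f = (\<Sum>j<N. ?f j)"
    by (rule suminf_finite) (auto simp: N)
  also have "real r * \<dots> = (\<Sum>j<N. real (d j mod r))"
    unfolding f using r by (simp add: sum_distrib_left)
  finally have eq: "real r * suminf ?f = real (\<Sum>j<N. d j mod r)" by simp
  show ?thesis unfolding psi_def fst_conv eq by (simp del: of_nat_sum)
qed

section \<open>The \<open>r\<close>-core is well defined\<close>

lemma confluentp_core_move: "confluentp (core_move r)"
proof (rule strong_confluentp_imp_confluentp, rule strong_confluentpI)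
  fix s t u assume "core_move r s t" "core_move r s u"
  then obtain k l where
    k: "s k = 1" "s (k + int r) = 0" "t = s(k := 0, k + int r := 1)" and
    l: "s l = 1" "s (l + int r) = 0" "u = s(l := 0, l + int r := 1)"
    unfolding core_move_def by blast
  show "\<exists>v. (core_move r)\<^sup>*\<^sup>* t v \<and> (core_move r)\<^sup>=\<^sup>= u v"
  proof (cases "k = l")
    case True
    then show ?thesis using k l by auto
  next
    case False
    have ne: "k \<noteq> l + int r" "l \<noteq> k + int r" using k l by auto
    let ?v = "t(l := 0, l + int r := 1)"
    have "core_move r t ?v"
      unfolding core_move_def using k l ne False by (intro exI[of _ l]) auto
    moreover have "?v = u(k := 0, k + int r := 1)"
      using k l ne False by (auto simp: fun_eq_iff)
    then have "core_move r u ?v"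
      unfolding core_move_def using k l ne False by (intro exI[of _ k]) auto
    ultimately show ?thesis by blast
  qed
qed

definition bead :: "(nat \<Rightarrow> nat) \<Rightarrow> nat \<Rightarrow> int" where
  "bead lam i = int (lam i) - int (Suc i)"

lemma zero_one_seq_bead: "zero_one_seq lam k = (if k \<in> range (bead lam) then 0 else 1)"
  by (auto simp: zero_one_seq_def bead_def)

lemma bead_less:
  assumes "lam \<in> partitions" "i < j"
  shows "bead lam j < bead lam i"
proof -
  have "lam j \<le> lam i" using assms by (auto simp: partitions_def antimono_def)
  then show ?thesis using assms(2) by (simp add: bead_def)
qed

lemma bead_inj:
  assumes "lam \<in> partitions" "bead lam i = bead lam j"
  shows "i = j"
  using bead_less[OF assms(1), of i j] bead_less[OF assms(1), of j i] assms(2)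
  by (cases i j rule: linorder_cases) auto

lemma zero_one_seq_inj:
  assumes l: "lam \<in> partitions" and m: "mu \<in> partitions"
    and eq: "zero_one_seq lam = zero_one_seq mu"
  shows "lam = mu"
proof -
  have rng: "range (bead lam) = range (bead mu)"
  proof -
    have "k \<in> range (bead lam) \<longleftrightarrow> k \<in> range (bead mu)" for k
      using fun_cong[OF eq, of k] unfolding zero_one_seq_bead by (auto split: if_splits)
    then show ?thesis by blast
  qed
  have aux: "bead a i \<le> bead b i"
    if a: "a \<in> partitions" and b: "b \<in> partitions" and ab: "range (bead a) = range (bead b)"
      and agree: "\<And>j. j < i \<Longrightarrow> bead a j = bead b j" for a b i
  proof -
    obtain k where k: "bead a i = bead b k" using ab by blast
    have "\<not> k < i" using agree[of k] k bead_inj[OF a, of i k] by auto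
    then have "bead b k \<le> bead b i"
      using bead_less[OF b, of i k] by (cases "k = i") auto
    with k show ?thesis by simp
  qed
  have "bead lam i = bead mu i" for i
  proof (induction i rule: less_induct)
    case (less i)
    show ?case
      using aux[OF l m rng] aux[OF m l rng[symmetric]] less by (metis order_antisym)
  qed
  then show ?thesis by (auto simp: bead_def fun_eq_iff)
qed

lemma partition_of_beads:
  fixes b :: "nat \<Rightarrow> int"
  assumes dec: "\<And>j. b (Suc j) < b j" and ev: "\<And>j. N \<le> j \<Longrightarrow> b j = - int (Suc j)"
  obtains mu where "mu \<in> partitions" "bead mu = b"
proof -
  define c where "c j = b j + int (Suc j)" for j
  have "c (Suc j) \<le> c j" for j using dec[of j] by (simp add: c_def)
  then have anti: "c j \<le> c i" if "i \<le> j" for i j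
    using lift_Suc_antimono_le[of c i j] that by blast
  have zero: "c j = 0" if "N \<le> j" for j using ev[OF that] by (simp add: c_def)
  have nonneg: "0 \<le> c j" for j using anti[of j "max j N"] zero[of "max j N"] by simp
  have "{i. nat (c i) \<noteq> 0} \<subseteq> {..<N}" using zero by (force simp: not_le[symmetric])
  then have "finite {i. nat (c i) \<noteq> 0}" by (rule finite_subset) simp
  moreover have "antimono (\<lambda>j. nat (c j))"
    by (auto simp: antimono_def intro!: nat_mono anti)
  ultimately have "(\<lambda>j. nat (c j)) \<in> partitions" unfolding partitions_def by blast
  moreover have "bead (\<lambda>j. nat (c j)) = b"
    using nonneg by (auto simp: fun_eq_iff bead_def) (simp add: c_def)
  ultimately show ?thesis using that by blast
qed

lemma core_move_partition:
  assumes r: "r > 0" and lam: "lam \<in> partitions" and mv: "core_move r (zero_one_seq lam) t"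
  obtains mu where "mu \<in> partitions" "t = zero_one_seq mu" "psize mu < psize lam"
proof -
  let ?b = "bead lam"
  obtain k where k1: "zero_one_seq lam k = 1" and k0: "zero_one_seq lam (k + int r) = 0"
    and t: "t = (zero_one_seq lam)(k := 0, k + int r := 1)"
    using mv unfolding core_move_def by blast
  have notk: "?b j \<noteq> k" for j using k1 by (auto simp: zero_one_seq_bead split: if_splits)
  obtain i where i: "?b i = k + int r"
    using k0 by (auto simp: zero_one_seq_bead split: if_splits)
  obtain N where N: "\<And>j. N \<le> j \<Longrightarrow> lam j = 0" using partitions_bound[OF lam] by blast
  define n where "n = (LEAST n. ?b n < k)"
  have "?b (N + nat \<bar>k\<bar>) < k" using N[of "N + nat \<bar>k\<bar>"] by (simp add: bead_def)
  then have n: "?b n < k" unfolding n_def by (rule LeastI)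
  have ltn: "k < ?b j" if "j < n" for j
    using not_less_Least[of j "\<lambda>n. ?b n < k"] that notk[of j] unfolding n_def by simp
  have "i < n"
    using n i r bead_less[OF lam, of n i] by (cases i n rule: linorder_cases) auto
  define b' where "b' j = (if j < i \<or> n \<le> j then ?b j else if Suc j = n then k else ?b (Suc j))"
    for j
  have dec: "b' (Suc j) < b' j" for j
    using bead_less[OF lam, of j "Suc j"] bead_less[OF lam, of j "Suc (Suc j)"]
      bead_less[OF lam, of "Suc j" "Suc (Suc j)"] ltn[of j] ltn[of "Suc j"] n \<open>i < n\<close>
    by (auto simp: b'_def not_less le_Suc_eq)
  have ev: "b' j = - int (Suc j)" if "max n N \<le> j" for j
    using that N[of j] by (simp add: b'_def bead_def)
  obtain mu where mu: "mu \<in> partitions" "bead mu = b'"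
    using partition_of_beads[of b', OF dec ev] by blast
  have img: "b' ` {..<M} = insert k (?b ` {..<M} - {?b i})" if "n \<le> M" for M
  proof (intro equalityI subsetI)
    fix x assume "x \<in> b' ` {..<M}"
    then obtain j where "j < M" "x = b' j" by auto
    then show "x \<in> insert k (?b ` {..<M} - {?b i})"
      using \<open>i < n\<close> that bead_inj[OF lam, of j i] bead_inj[OF lam, of "Suc j" i]
      by (auto simp: b'_def split: if_splits)
  next
    fix x assume "x \<in> insert k (?b ` {..<M} - {?b i})"
    then consider "x = k" | j where "j < M" "x = ?b j" "j \<noteq> i" by auto
    then show "x \<in> b' ` {..<M}"
    proof cases
      case 1
      then have "x = b' (n - 1)" using \<open>i < n\<close> by (auto simp: b'_def)
      then show ?thesis using \<open>i < n\<close> that by auto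
    next
      case 2
      show ?thesis
      proof (cases "j < i \<or> n \<le> j")
        case True
        then have "x = b' j" using 2 by (simp add: b'_def)
        then show ?thesis using 2 by auto
      next
        case False
        then have "x = b' (j - 1)" using 2 by (auto simp: b'_def)
        then show ?thesis using 2 by auto
      qed
    qed
  qed
  have rng: "range b' = insert k (range ?b - {?b i})"
  proof -
    have U: "range f = (\<Union>M\<in>{n..}. f ` {..<M})" for f :: "nat \<Rightarrow> int"
    proof -
      have "\<exists>M\<ge>n. f x \<in> f ` {..<M}" for x by (rule exI[of _ "max n (Suc x)"]) auto
      then show ?thesis by fastforce
    qed
    show ?thesis unfolding U[of b'] U[of ?b] using img by auto
  qed
  have "t = zero_one_seq mu"
    using notk i r by (auto simp: t fun_eq_iff zero_one_seq_bead mu(2) rng)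
  moreover have "psize mu < psize lam"
  proof -
    obtain N' where N': "\<And>j. N' \<le> j \<Longrightarrow> mu j = 0" using partitions_bound[OF mu(1)] by blast
    define M where "M = max n (max N N')"
    have ps: "psize lam = sum lam {..<M}" "psize mu = sum mu {..<M}"
      unfolding psize_def by (rule suminf_finite; auto simp: N N' M_def)+
    have inj: "inj_on ?b {..<M}" "inj_on b' {..<M}"
      using bead_inj[OF lam] bead_inj[OF mu(1)] mu(2) by (auto simp: inj_on_def)
    have "sum b' {..<M} = \<Sum>(b' ` {..<M})" using inj(2) by (simp add: sum.reindex)
    also have "\<dots> = k + \<Sum>(?b ` {..<M} - {?b i})"
    proof -
      have "k \<notin> ?b ` {..<M} - {?b i}" using notk by (auto dest: sym)
      moreover have "n \<le> M" by (simp add: M_def)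
      ultimately show ?thesis by (simp add: img)
    qed
    also have "\<Sum>(?b ` {..<M} - {?b i}) = \<Sum>(?b ` {..<M}) - ?b i"
      using \<open>i < n\<close> by (subst sum_diff1) (auto simp: M_def)
    also have "\<Sum>(?b ` {..<M}) = sum ?b {..<M}" using inj(1) by (simp add: sum.reindex)
    finally have "sum (bead mu) {..<M} < sum (bead lam) {..<M}" using i r mu(2) by simp
    then have "int (sum mu {..<M}) < int (sum lam {..<M})"
      by (simp add: bead_def sum_subtractf)
    then show ?thesis unfolding ps by (simp only: of_nat_less_iff)
  qed
  ultimately show ?thesis using that mu(1) by blast
qed

lemma ex1_r_core:
  assumes r: "r > 0" and lam: "lam \<in> partitions"
  shows "\<exists>!kap. is_r_core_of r lam kap"
proof (rule ex_ex1I)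
  show "\<exists>kap. is_r_core_of r lam kap"
    using lam
  proof (induction "psize lam" arbitrary: lam rule: less_induct)
    case less
    show ?case
    proof (cases "\<exists>t. core_move r (zero_one_seq lam) t")
      case False
      then show ?thesis using less.prems by (auto simp: is_r_core_of_def)
    next
      case True
      then obtain mu where mu: "mu \<in> partitions" "psize mu < psize lam"
        "core_move r (zero_one_seq lam) (zero_one_seq mu)"
        using core_move_partition[OF r less.prems] by metis
      then show ?thesis using less.hyps[OF mu(2,1)]
        unfolding is_r_core_of_def by (meson converse_rtranclp_into_rtranclp)
    qed
  qed
next
  fix a b assume a: "is_r_core_of r lam a" and b: "is_r_core_of r lam b"
  obtain u where "(core_move r)\<^sup>*\<^sup>* (zero_one_seq a) u" "(core_move r)\<^sup>*\<^sup>* (zero_one_seq b) u"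
    using confluentpD[OF confluentp_core_move] a b unfolding is_r_core_of_def by blast
  then have "zero_one_seq a = u" "zero_one_seq b = u"
    using a b unfolding is_r_core_of_def by (metis converse_rtranclpE)+
  then show "a = b" using zero_one_seq_inj a b unfolding is_r_core_of_def by metis
qed

end

theory Submission
  imports Defs
begin

text \<open>
  The statement becomes transparent when it is read through the inverse of the map: the pair
  \<open>(mu, nu)\<close> corresponds to the partition \<open>lam = mu + r * nu\<close>, taken row by row.  A partition
  is determined by its differences \<open>lam i - lam (Suc i)\<close>, and every finitely supported sequence
  of natural numbers occurs as such (\<open>partition_with_differences\<close>).  An \<open>r\<close>-kernel is a
  partition whose differences are all smaller than \<open>r\<close>, since the bottom squares in row \<open>i\<close>
  have the hook-lengths \<open>1, \<dots>, lam i - lam (Suc i)\<close>.  Hence writing \<open>lam = mu + r * nu\<close> with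
  \<open>mu\<close> a kernel amounts to dividing each difference of \<open>lam\<close> by \<open>r\<close> with remainder, and this
  is what \<open>psi r\<close> does (\<open>psi_add_mult\<close>).

  The three identities are then read off from \<open>lam = mu + r * nu\<close>.  The one for sizes is
  additivity.  The hook-lengths in row \<open>i\<close> that are divisible by \<open>r\<close> are \<open>r, 2r, \<dots>, qr\<close>, where
  \<open>q\<close> is the quotient of the difference by \<open>r\<close>, so they are \<open>r\<close> times the bottom hook-lengths of
  \<open>nu\<close> in that row.  For the cores, \<open>nu\<close> is dismantled one square at a time, always at the
  end of its last nonempty row; each time \<open>mu + r * nu\<close> loses \<open>r\<close> squares of a single row, which
  moves one zero of the \<open>0/1\<close>-sequence \<open>r\<close> places to the left (\<open>core_move_shorten_row\<close>).  Such
  moves do not change the core, and they end at \<open>mu\<close>.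
\<close>

section \<open>Partitions and their differences\<close>

lemma partitionsI:
  assumes "\<And>i. lam (Suc i) \<le> lam i" and "\<And>i. N \<le> i \<Longrightarrow> lam i = 0"
  shows "lam \<in> partitions"
proof -
  have "i < N" if "lam i \<noteq> 0" for i
    using assms(2)[of i] that by (cases "i < N") auto
  then have "{i. lam i \<noteq> 0} \<subseteq> {..<N}" by blast
  then have "finite {i. lam i \<noteq> 0}" by (rule finite_subset) simp
  moreover have "antimono lam"
    using lift_Suc_antimono_le[of lam, OF assms(1)] by (auto simp: antimono_def)
  ultimately show ?thesis by (simp add: partitions_def)
qed

lemma partitions_mono: "lam \<in> partitions \<Longrightarrow> i \<le> j \<Longrightarrow> lam j \<le> lam i"
  by (auto simp: partitions_def antimono_def)

lemma partitions_Suc: "lam \<in> partitions \<Longrightarrow> lam (Suc i) \<le> lam i"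
  by (simp add: partitions_mono)

lemma partitions_common_bound:
  assumes "lam \<in> partitions" "mu \<in> partitions"
  obtains N where "\<And>j. N \<le> j \<Longrightarrow> lam j = 0" "\<And>j. N \<le> j \<Longrightarrow> mu j = 0"
proof -
  obtain N M where "\<And>j. N \<le> j \<Longrightarrow> lam j = 0" "\<And>j. M \<le> j \<Longrightarrow> mu j = 0"
    using partitions_bound assms by metis
  then show ?thesis using that[of "max N M"] by simp
qed

lemma add_mult_partitions:
  assumes "mu \<in> partitions" "nu \<in> partitions"
  shows "(\<lambda>i. mu i + r * nu i) \<in> partitions"
proof -
  obtain N where "\<And>j. N \<le> j \<Longrightarrow> mu j = 0" "\<And>j. N \<le> j \<Longrightarrow> nu j = 0"
    using partitions_common_bound assms by metis
  then have "mu i + r * nu i = 0" if "N \<le> i" for i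
    using that by simp
  moreover have "mu (Suc i) + r * nu (Suc i) \<le> mu i + r * nu i" for i
    by (rule add_mono[OF partitions_Suc mult_left_mono[OF partitions_Suc]]) (use assms in auto)
  ultimately show ?thesis
    by (intro partitionsI[where N = N]) blast+
qed

lemma suminf_differences:
  assumes lam: "lam \<in> partitions"
  shows "(\<Sum>j. lam (i + j) - lam (i + j + 1)) = lam i"
proof -
  obtain N where N: "\<And>j. N \<le> j \<Longrightarrow> lam j = 0"
    using partitions_bound[OF lam] by blast
  have fin: "(\<Sum>j<n. lam (i + j) - lam (i + j + 1)) = lam i - lam (i + n)" for n
  proof (induction n)
    case (Suc n)
    show ?case
      using Suc partitions_mono[OF lam, of i "i + n"] partitions_Suc[OF lam, of "i + n"] by simp
  qed simp
  have "(\<Sum>j. lam (i + j) - lam (i + j + 1)) = (\<Sum>j<N. lam (i + j) - lam (i + j + 1))"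
    by (rule suminf_finite) (auto simp: N)
  then show ?thesis unfolding fin by (simp add: N)
qed

lemma partitions_eqI:
  assumes "lam \<in> partitions" "mu \<in> partitions"
    and "\<And>i. lam i - lam (Suc i) = mu i - mu (Suc i)"
  shows "lam = mu"
proof
  fix i
  show "lam i = mu i"
    using suminf_differences[OF assms(1), of i] suminf_differences[OF assms(2), of i]
    by (simp only: assms(3) Suc_eq_plus1[symmetric])
qed

lemma partition_with_differences:
  fixes d :: "nat \<Rightarrow> nat"
  assumes "\<And>i. N \<le> i \<Longrightarrow> d i = 0"
  obtains lam where "lam \<in> partitions" "\<And>i. lam i = d i + lam (Suc i)"
proof -
  define lam where "lam i = (\<Sum>j\<in>{i..<N}. d j)" for i
  have rec: "lam i = d i + lam (Suc i)" for i
    using assms[of i] sum.atLeast_Suc_lessThan[of i N d] by (cases "i < N") (simp_all add: lam_def)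
  have "lam (Suc i) \<le> lam i" for i using rec[of i] by linarith
  then have "lam \<in> partitions"
    by (rule partitionsI[where N = N]) (simp add: lam_def)
  from that[OF this rec] show ?thesis .
qed

section \<open>Bottom squares\<close>

text \<open>
  The rows that meet column \<open>j\<close> form an initial segment, because the parts decrease.  So a
  square has nothing below it exactly if the next row already ends before its column.
\<close>

lemma bottom_squares_eq:
  assumes lam: "lam \<in> partitions"
  shows "bottom_squares lam = {(i, j). lam (Suc i) \<le> j \<and> j < lam i}"
proof -
  have "leg lam (i, j) = 0 \<longleftrightarrow> lam (Suc i) \<le> j" if "j < lam i" for i j
  proof -
    obtain N where N: "\<And>j. N \<le> j \<Longrightarrow> lam j = 0"
      using partitions_bound[OF lam] by blast
    have "k < N" if "j < lam k" for k
      using N[of k] that by (cases "k < N") auto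
    then have fin: "finite {k. j < lam k}"
      by (auto intro: finite_subset[of _ "{..<N}"])
    show ?thesis
    proof
      assume "lam (Suc i) \<le> j"
      have "k \<le> i" if "j < lam k" for k
        using partitions_mono[OF lam, of "Suc i" k] that \<open>lam (Suc i) \<le> j\<close> by linarith
      then have "{k. j < lam k} \<subseteq> {..i}" by auto
      then have "conjugate lam j \<le> card {..i}"
        unfolding conjugate_def by (rule card_mono[OF finite_atMost])
      then show "leg lam (i, j) = 0" by (simp add: leg_def)
    next
      assume leg: "leg lam (i, j) = 0"
      show "lam (Suc i) \<le> j"
      proof (rule ccontr)
        assume "\<not> lam (Suc i) \<le> j"
        then have "j < lam k" if "k \<le> Suc i" for k
          using partitions_mono[OF lam that] by linarith
        then have "{..Suc i} \<subseteq> {k. j < lam k}" by auto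
        then have "card {..Suc i} \<le> conjugate lam j"
          unfolding conjugate_def by (rule card_mono[OF fin])
        then show False using leg by (simp add: leg_def)
      qed
    qed
  qed
  then show ?thesis by (auto simp: bottom_squares_def diagram_def)
qed

lemma hook_length_bottom:
  assumes "(i, j) \<in> bottom_squares lam"
  shows "hook_length lam (i, j) = lam i - j"
  using assms by (auto simp: bottom_squares_def diagram_def hook_length_def arm_def)

lemma finite_bottom_squares:
  assumes lam: "lam \<in> partitions"
  shows "finite (bottom_squares lam)"
proof -
  obtain N where N: "\<And>j. N \<le> j \<Longrightarrow> lam j = 0"
    using partitions_bound[OF lam] by blast
  have "bottom_squares lam \<subseteq> {..<N} \<times> {..<lam 0}"
  proof (clarsimp simp: bottom_squares_eq[OF lam])
    fix i j assume "j < lam i"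
    then show "i < N \<and> j < lam 0"
      using N[of i] partitions_mono[OF lam, of 0 i] by (cases "i < N") auto
  qed
  then show ?thesis by (rule finite_subset) simp
qed

lemma bottom_hooks_eq:
  assumes "lam \<in> partitions"
  shows "bottom_hooks r lam =
     image_mset (hook_length lam) (mset_set {s \<in> bottom_squares lam. r dvd hook_length lam s})"
  using finite_bottom_squares[OF assms] by (simp add: bottom_hooks_def filter_mset_image_mset)

lemma r_kernels_iff:
  assumes r: "r > 0"
  shows "mu \<in> r_kernels r \<longleftrightarrow> mu \<in> partitions \<and> (\<forall>i. mu i - mu (Suc i) < r)"
proof (cases "mu \<in> partitions")
  case mu: True
  have "bottom_hooks r mu = {#} \<longleftrightarrow> {s \<in> bottom_squares mu. r dvd hook_length mu s} = {}"
    using finite_bottom_squares[OF mu] by (simp add: bottom_hooks_eq[OF mu] mset_set_empty_iff)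
  also have "\<dots> \<longleftrightarrow> (\<forall>i. mu i - mu (Suc i) < r)"
  proof (intro iffI allI)
    fix i
    assume empty: "{s \<in> bottom_squares mu. r dvd hook_length mu s} = {}"
    show "mu i - mu (Suc i) < r"
    proof (rule ccontr)
      assume "\<not> mu i - mu (Suc i) < r"
      then have sq: "(i, mu i - r) \<in> bottom_squares mu" and "r \<le> mu i"
        using r by (auto simp: bottom_squares_eq[OF mu])
      then have "r dvd hook_length mu (i, mu i - r)" by (simp add: hook_length_bottom)
      then show False using empty sq by blast
    qed
  next
    assume small: "\<forall>i. mu i - mu (Suc i) < r"
    have "\<not> r dvd hook_length mu (i, j)" if "(i, j) \<in> bottom_squares mu" for i j
    proof -
      have "0 < mu i - j" "mu i - j < r"
        using that small[rule_format, of i] by (auto simp: bottom_squares_eq[OF mu])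
      then show ?thesis using that by (auto simp: hook_length_bottom dest: dvd_imp_le)
    qed
    then show "{s \<in> bottom_squares mu. r dvd hook_length mu s} = {}" by auto
  qed
  finally show ?thesis using mu by (simp add: r_kernels_def)
qed (simp add: r_kernels_def)

text \<open>
  The bottom square of \<open>nu\<close> with hook-length \<open>h\<close> in row \<open>i\<close> corresponds to the square with
  hook-length \<open>r * h\<close> in the same row of \<open>mu + r * nu\<close>.  Since the differences of \<open>mu\<close> are smaller
  than \<open>r\<close>, there is no room for a further multiple of \<open>r\<close>.
\<close>

lemma bottom_hooks_add_mult:
  assumes r: "r > 0" and mu: "mu \<in> r_kernels r" and nu: "nu \<in> partitions"
  shows "bottom_hooks r (\<lambda>i. mu i + r * nu i) = image_mset (\<lambda>h. r * h) (bottom_hooks 1 nu)"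
proof -
  define lam where "lam = (\<lambda>i. mu i + r * nu i)"
  have mu': "mu \<in> partitions" and small: "\<And>i. mu i - mu (Suc i) < r"
    using mu r_kernels_iff[OF r] by auto
  have lam: "lam \<in> partitions"
    unfolding lam_def by (rule add_mult_partitions[OF mu' nu])
  define f where "f = (\<lambda>(i, j). (i, lam i - r * (nu i - j)))"
  let ?B = "{s \<in> bottom_squares lam. r dvd hook_length lam s}"
  have le: "r * (nu i - j) \<le> lam i" for i j
    by (simp add: lam_def trans_le_add2)
  have f: "f s \<in> bottom_squares lam \<and> hook_length lam (f s) = r * hook_length nu s"
    if s: "s \<in> bottom_squares nu" for s
  proof -
    obtain i j where ij: "s = (i, j)" by force
    have j: "nu (Suc i) \<le> j" "j < nu i" using s ij by (auto simp: bottom_squares_eq[OF nu])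
    have "r * (nu i - j + nu (Suc i)) \<le> r * nu i"
      using j by (intro mult_left_mono) auto
    then have "lam (Suc i) + r * (nu i - j) \<le> lam i"
      using partitions_Suc[OF mu', of i] by (simp add: lam_def distrib_left)
    moreover have "0 < r * (nu i - j)" using r j by simp
    ultimately have "lam (Suc i) \<le> lam i - r * (nu i - j)" "lam i - r * (nu i - j) < lam i"
      by linarith+
    then have "f s \<in> bottom_squares lam"
      by (simp add: f_def ij bottom_squares_eq[OF lam])
    then show ?thesis
      using s le[of i j] hook_length_bottom[of i "lam i - r * (nu i - j)" lam]
      by (auto simp: f_def ij hook_length_bottom)
  qed
  have inj: "inj_on f (bottom_squares nu)"
  proof (rule inj_onI)
    fix s t assume st: "s \<in> bottom_squares nu" "t \<in> bottom_squares nu" "f s = f t"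
    obtain i j k l where ij: "s = (i, j)" "t = (k, l)" by force
    have "i = k" using st(3) by (simp add: f_def ij)
    moreover have "r * hook_length nu s = r * hook_length nu t"
      using f[OF st(1)] f[OF st(2)] st(3) by metis
    ultimately have "nu i - j = nu i - l" "j < nu i" "l < nu i"
      using st r by (auto simp: ij hook_length_bottom bottom_squares_eq[OF nu])
    then show "s = t" using \<open>i = k\<close> by (simp add: ij)
  qed
  have surj: "f ` bottom_squares nu = ?B"
  proof (intro equalityI subsetI)
    fix t assume t: "t \<in> ?B"
    obtain i k where ik: "t = (i, k)" by force
    have k: "lam (Suc i) \<le> k" "k < lam i" using t ik by (auto simp: bottom_squares_eq[OF lam])
    have "r dvd lam i - k" using t by (auto simp: ik hook_length_bottom)
    then obtain h where h: "lam i - k = r * h" by blast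
    have "r * h + lam (Suc i) \<le> lam i" using k h by linarith
    \<comment> \<open>The kernel contributes less than one full \<open>r\<close> to the difference, which rounding down removes.\<close>
    then have "r * (h + nu (Suc i)) < r * (nu i + 1)"
      using small[of i] by (simp add: lam_def algebra_simps)
    then have "h + nu (Suc i) < nu i + 1" by (rule mult_less_cancel1[THEN iffD1, THEN conjunct2])
    then have "h + nu (Suc i) \<le> nu i" by simp
    moreover have "0 < h" using k h by (cases "h = 0") auto
    ultimately have "(i, nu i - h) \<in> bottom_squares nu" "nu i - (nu i - h) = h"
      by (auto simp: bottom_squares_eq[OF nu])
    moreover from this(2) have "f (i, nu i - h) = t"
      using k by (simp add: f_def ik flip: h)
    ultimately show "t \<in> f ` bottom_squares nu" by force
  qed (use f in auto)
  have "bottom_hooks r lam = image_mset (hook_length lam) (image_mset f (mset_set (bottom_squares nu)))"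
    by (simp add: bottom_hooks_eq[OF lam] image_mset_mset_set[OF inj] surj)
  also have "\<dots> = image_mset (\<lambda>s. r * hook_length nu s) (mset_set (bottom_squares nu))"
    using f finite_bottom_squares[OF nu] by (auto simp: multiset.map_comp intro!: image_mset_cong)
  also have "\<dots> = image_mset (\<lambda>h. r * h) (bottom_hooks 1 nu)"
    by (simp add: bottom_hooks_eq[OF nu] multiset.map_comp comp_def)
  finally show ?thesis by (simp add: lam_def)
qed

section \<open>Division with remainder of a partition\<close>

lemma partition_division:
  assumes r: "r > 0" and lam: "lam \<in> partitions"
  obtains mu nu where "mu \<in> r_kernels r" "nu \<in> partitions" "lam = (\<lambda>i. mu i + r * nu i)"
proof -
  define d where "d i = lam i - lam (Suc i)" for i
  obtain N where N: "\<And>j. N \<le> j \<Longrightarrow> lam j = 0"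
    using partitions_bound[OF lam] by blast
  obtain mu where mu: "mu \<in> partitions" "\<And>i. mu i = d i mod r + mu (Suc i)"
    using partition_with_differences[of N "\<lambda>i. d i mod r"] N by (auto simp: d_def)
  obtain nu where nu: "nu \<in> partitions" "\<And>i. nu i = d i div r + nu (Suc i)"
    using partition_with_differences[of N "\<lambda>i. d i div r"] N by (auto simp: d_def)
  have "mu i - mu (Suc i) < r" for i
    using mu(2)[of i] r by simp
  then have "mu \<in> r_kernels r"
    using mu(1) by (simp add: r_kernels_iff[OF r])
  moreover have "lam = (\<lambda>i. mu i + r * nu i)"
  proof (rule partitions_eqI[OF lam add_mult_partitions[OF mu(1) nu(1)]])
    fix i
    have "mu i + r * nu i = d i mod r + r * (d i div r) + (mu (Suc i) + r * nu (Suc i))"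
      by (simp only: mu(2)[of i] nu(2)[of i] distrib_left ac_simps)
    then show "lam i - lam (Suc i) = mu i + r * nu i - (mu (Suc i) + r * nu (Suc i))"
      by (simp add: d_def)
  qed
  ultimately show ?thesis using nu(1) that by blast
qed

text \<open>
  The difference of \<open>mu + r * nu\<close> in row \<open>k\<close>, divided by \<open>r\<close>, has the difference of \<open>nu\<close> as its
  integral part and that of \<open>mu\<close>, divided by \<open>r\<close>, as its fractional part.  Both series in
  \<open>psi\<close> therefore telescope.
\<close>

lemma psi_add_mult:
  assumes r: "r > 0" and mu: "mu \<in> r_kernels r" and nu: "nu \<in> partitions"
  shows "psi r (\<lambda>i. mu i + r * nu i) = (mu, nu)"
proof -
  define lam where "lam = (\<lambda>i. mu i + r * nu i)"
  have mu': "mu \<in> partitions" and small: "\<And>i. mu i - mu (Suc i) < r"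
    using mu r_kernels_iff[OF r] by auto
  have lam: "lam \<in> partitions"
    unfolding lam_def by (rule add_mult_partitions[OF mu' nu])
  define q where "q k = (real (lam k) - real (lam (k + 1))) / real r" for k
  define x where "x k = real (mu k - mu (k + 1)) / real r" for k
  have q: "q k = x k + of_int (int (nu k - nu (k + 1)))" for k
    using r partitions_Suc[OF mu', of k] partitions_Suc[OF nu, of k]
    by (simp add: q_def x_def lam_def of_nat_diff field_simps)
  have x: "0 \<le> x k" "x k < 1" for k
    using r small[of k] by (simp_all add: x_def)
  have frac: "frac (q k) = x k" for k
    unfolding frac_unique_iff using x[of k] q[of k] by simp
  have floor: "nat \<lfloor>q k\<rfloor> = nu k - nu (k + 1)" for k
    using frac[of k] q[of k] by (simp add: frac_def)
  have "fst (psi r lam) = mu"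
  proof
    fix i
    have "(\<lambda>j. real (mu (i + j)) / real r) \<longlonglongrightarrow> 0"
    proof -
      obtain N where N: "\<And>j. N \<le> j \<Longrightarrow> mu j = 0"
        using partitions_bound[OF mu'] by blast
      show ?thesis
        by (rule tendsto_eventually) (auto simp: eventually_sequentially N intro!: exI[of _ N])
    qed
    then have "(\<lambda>j. real (mu (i + j)) / real r - real (mu (i + Suc j)) / real r) sums
        (real (mu (i + 0)) / real r - 0)"
      by (rule telescope_sums')
    moreover have "x (i + j) = real (mu (i + j)) / real r - real (mu (i + Suc j)) / real r" for j
      using partitions_Suc[OF mu', of "i + j"] by (simp add: x_def of_nat_diff diff_divide_distrib)
    ultimately have "(\<Sum>j. x (i + j)) = real (mu i) / real r"
      by (simp add: sums_iff)
    then have "real (fst (psi r lam) i) = real (mu i)"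
      using r real_fst_psi[OF r lam, of i, folded q_def] by (simp add: frac)
    then show "fst (psi r lam) i = mu i" by simp
  qed
  moreover have "snd (psi r lam) = nu"
    unfolding psi_def snd_conv q_def[symmetric] floor suminf_differences[OF nu] ..
  ultimately show ?thesis by (simp add: lam_def prod_eq_iff)
qed

lemma psize_add_mult:
  assumes "mu \<in> partitions" "nu \<in> partitions"
  shows "psize (\<lambda>i. mu i + r * nu i) = psize mu + r * psize nu"
proof -
  obtain N where N: "\<And>j. N \<le> j \<Longrightarrow> mu j = 0" "\<And>j. N \<le> j \<Longrightarrow> nu j = 0"
    using partitions_common_bound assms by metis
  have "psize p = sum p {..<N}" if "\<And>j. N \<le> j \<Longrightarrow> p j = 0" for p
    unfolding psize_def by (rule suminf_finite) (auto simp: that)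
  then show ?thesis using N by (simp add: sum.distrib sum_distrib_left)
qed

section \<open>Cores\<close>

lemma r_core_eq_if_core_moves:
  assumes r: "r > 0" and "lam \<in> partitions" "mu \<in> partitions"
    and moves: "(core_move r)\<^sup>*\<^sup>* (zero_one_seq lam) (zero_one_seq mu)"
  shows "r_core r lam = r_core r mu"
proof -
  obtain kap where kap: "is_r_core_of r mu kap"
    using ex1_r_core[OF r assms(3)] by blast
  then have "is_r_core_of r lam kap"
    using moves by (auto simp: is_r_core_of_def)
  then show ?thesis
    using kap ex1_r_core[OF r assms(2)] ex1_r_core[OF r assms(3)]
    unfolding r_core_def by (metis the1_equality)
qed

text \<open>
  Shortening row \<open>i\<close> moves the zero at position \<open>bead lam i\<close> to \<open>bead mu i\<close>.  That place was not
  occupied before: all the other zeros stay where they are, and the zeros of \<open>mu\<close> sit at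
  pairwise distinct positions.
\<close>

lemma core_move_shorten_row:
  assumes r: "r > 0" and lam: "lam \<in> partitions" and mu: "mu \<in> partitions"
    and row: "lam i = mu i + r" and same: "\<And>j. j \<noteq> i \<Longrightarrow> lam j = mu j"
  shows "core_move r (zero_one_seq lam) (zero_one_seq mu)"
proof -
  have b: "bead lam i = bead mu i + int r" using row by (simp add: bead_def)
  have b': "bead lam j = bead mu j" if "j \<noteq> i" for j using same[OF that] by (simp add: bead_def)
  have free: "bead mu i \<notin> range (bead lam)"
  proof
    assume "bead mu i \<in> range (bead lam)"
    then obtain j where j: "bead mu i = bead lam j" by blast
    then show False using r b b'[of j] bead_inj[OF mu, of i j] by (cases "j = i") auto
  qed
  have gone: "bead lam i \<notin> range (bead mu)"
  proof
    assume "bead lam i \<in> range (bead mu)"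
    then obtain j where j: "bead lam i = bead mu j" by blast
    then show False using r b b'[of j] bead_inj[OF lam, of i j] by (cases "j = i") auto
  qed
  have range_iff: "k \<in> range (bead mu) \<longleftrightarrow> k \<in> range (bead lam)"
    if "k \<noteq> bead mu i" "k \<noteq> bead lam i" for k
  proof -
    have "k = bead mu j \<longleftrightarrow> k = bead lam j" for j
      using that b'[of j] by (cases "j = i") auto
    then show ?thesis by blast
  qed
  have "zero_one_seq mu =
      (zero_one_seq lam)(bead mu i := 0, bead mu i + int r := 1)"
    using gone range_iff b r by (auto simp: fun_eq_iff zero_one_seq_bead)
  moreover have "zero_one_seq lam (bead mu i) = 1" "zero_one_seq lam (bead mu i + int r) = 0"
    using free by (simp_all add: zero_one_seq_bead flip: b)
  ultimately show ?thesis unfolding core_move_def by blast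
qed

lemma core_moves_add_mult:
  assumes r: "r > 0" and mu: "mu \<in> partitions" and nu: "nu \<in> partitions"
  shows "(core_move r)\<^sup>*\<^sup>* (zero_one_seq (\<lambda>i. mu i + r * nu i)) (zero_one_seq mu)"
  using nu
proof (induction "psize nu" arbitrary: nu rule: less_induct)
  case less
  show ?case
  proof (cases "\<forall>i. nu i = 0")
    case False
    \<comment> \<open>Only a square whose removal leaves a partition may be taken away, such as the end of the last row.\<close>
    define i where "i = Max {i. nu i \<noteq> 0}"
    have fin: "finite {i. nu i \<noteq> 0}" using less.prems by (simp add: partitions_def)
    then have i: "nu i \<noteq> 0" using Max_in[OF fin] False by (auto simp: i_def)
    have last: "nu j = 0" if "i < j" for j
      using Max_ge[OF fin, of j] that by (force simp: i_def)
    define nu' where "nu' = nu(i := nu i - 1)"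
    have nu': "nu' \<in> partitions"
    proof (rule partitionsI)
      show "nu' (Suc j) \<le> nu' j" for j
        using partitions_Suc[OF less.prems, of j] last[of "Suc j"] by (auto simp: nu'_def)
      show "nu' j = 0" if "Suc i \<le> j" for j
        using last[of j] that by (simp add: nu'_def)
    qed
    have "psize p = sum p {..<Suc i}" if "\<And>j. i < j \<Longrightarrow> p j = 0" for p
      unfolding psize_def by (rule suminf_finite) (auto simp: that)
    then have "psize nu = sum nu {..<Suc i}" "psize nu' = sum nu' {..<Suc i}"
      using last by (simp_all add: nu'_def)
    moreover have "sum nu' {..<i} = sum nu {..<i}"
      by (rule sum.cong) (auto simp: nu'_def)
    ultimately have "psize nu' < psize nu" using i by (simp add: nu'_def)
    then have "(core_move r)\<^sup>*\<^sup>* (zero_one_seq (\<lambda>j. mu j + r * nu' j)) (zero_one_seq mu)"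
      using less.hyps nu' by blast
    moreover have "core_move r (zero_one_seq (\<lambda>j. mu j + r * nu j)) (zero_one_seq (\<lambda>j. mu j + r * nu' j))"
    proof (rule core_move_shorten_row[OF r, where i = i])
      show "mu i + r * nu i = mu i + r * nu' i + r"
        using i by (cases "nu i") (simp_all add: nu'_def)
      show "(\<lambda>j. mu j + r * nu j) \<in> partitions" "(\<lambda>j. mu j + r * nu' j) \<in> partitions"
        using mu nu' less.prems by (blast intro: add_mult_partitions)+
    qed (simp add: nu'_def)
    ultimately show ?thesis by (blast intro: converse_rtranclp_into_rtranclp)
  qed simp
qed

section \<open>The bijection\<close>

theorem proposition6p2:
  fixes r :: nat
  assumes "r > 0"
  shows "bij_betw (psi r) partitions (r_kernels r \<times> partitions) \<and>
    (\<forall>lam\<in>partitions. \<forall>mu nu. psi r lam = (mu, nu) \<longrightarrow>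
       r_core r lam = r_core r mu \<and>
       psize lam = psize mu + r * psize nu \<and>
       bottom_hooks r lam = image_mset (\<lambda>h. r * h) (bottom_hooks 1 nu))"
proof (intro conjI ballI allI impI)
  have kernel: "mu \<in> partitions" if "mu \<in> r_kernels r" for mu
    using that by (simp add: r_kernels_def)
  have inverse: "mu \<in> r_kernels r \<and> nu \<in> partitions \<and> lam = (\<lambda>i. mu i + r * nu i)"
    if "lam \<in> partitions" "psi r lam = (mu, nu)" for lam mu nu
    using partition_division[OF assms that(1)] psi_add_mult[OF assms] that(2) by (metis prod.inject)
  show "bij_betw (psi r) partitions (r_kernels r \<times> partitions)"
  proof (rule bij_betw_byWitness[where f' = "\<lambda>(mu, nu) i. mu i + r * nu i"])
    show "\<forall>lam\<in>partitions. (\<lambda>(mu, nu) i. mu i + r * nu i) (psi r lam) = lam"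
      using inverse by (fastforce split: prod.split)
    show "\<forall>p\<in>r_kernels r \<times> partitions. psi r ((\<lambda>(mu, nu) i. mu i + r * nu i) p) = p"
      using psi_add_mult[OF assms] by auto
    show "psi r ` partitions \<subseteq> r_kernels r \<times> partitions"
    proof
      fix p assume "p \<in> psi r ` partitions"
      then obtain lam where "lam \<in> partitions" "psi r lam = (fst p, snd p)" by auto
      then show "p \<in> r_kernels r \<times> partitions"
        using inverse[of lam "fst p" "snd p"] by (simp add: mem_Times_iff)
    qed
    show "(\<lambda>(mu, nu) i. mu i + r * nu i) ` (r_kernels r \<times> partitions) \<subseteq> partitions"
      using kernel add_mult_partitions by auto
  qed
  fix lam mu nu
  assume lam: "lam \<in> partitions" and psi: "psi r lam = (mu, nu)"
  have mu: "mu \<in> r_kernels r" and nu: "nu \<in> partitions" and eq: "lam = (\<lambda>i. mu i + r * nu i)"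
    using inverse[OF lam psi] by auto
  show "r_core r lam = r_core r mu"
    using r_core_eq_if_core_moves[OF assms lam kernel[OF mu]]
      core_moves_add_mult[OF assms kernel[OF mu] nu] eq by simp
  show "psize lam = psize mu + r * psize nu"
    unfolding eq by (rule psize_add_mult[OF kernel[OF mu] nu])
  show "bottom_hooks r lam = image_mset (\<lambda>h. r * h) (bottom_hooks 1 nu)"
    unfolding eq by (rule bottom_hooks_add_mult[OF assms mu nu])
qed

end
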